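(* Let $(X_i^{\top},Y_i)^{\top}$, $1\le i\le n$, be random vectors in $\mathbb{R}^p\times\mathbb{R}$ with finite second moments (no assumption on their dependence or distributions), and let $$\hat{\Sigma}_n := \frac1n\sum_{i=1}^n X_iX_i^{\top},\quad \hat{\Gamma}_n := \frac1n\sum_{i=1}^n X_iY_i,\quad \Sigma_n := \frac1n\sum_{i=1}^n \mathbb{E}[X_iX_i^{\top}],\quad \Gamma_n := \frac1n\sum_{i=1}^n \mathbb{E}[X_iY_i].$$ Assume $\Sigma_n$ is invertible, and set $\hat{\beta}_n := \hat{\Sigma}_n^{-1}\hat{\Gamma}_n$, $\beta_n := \Sigma_n^{-1}\Gamma_n$, $\Lambda_n := \lambda_{\min}(\Sigma_n)$ and $\mathcal{D}_{2n}^{\Sigma} := \|\hat{\Sigma}_n-\Sigma_n\|_{op}$. If $\mathcal{D}_{2n}^{\Sigma}\le \Lambda_n/2$, then $$\frac12\left\|\Sigma_n^{-1}(\hat{\Gamma}_n-\hat{\Sigma}_n\beta_n)\right\|_2\ \le\ \|\hat{\beta}_n-\beta_n\|_2\ \le\ 2\left\|\Sigma_n^{-1}(\hat{\Gamma}_n-\hat{\Sigma}_n\beta_n)\right\|_2,$$ and $$\left\|\hat{\beta}_n-\beta_n-\Sigma_n^{-1}(\hat{\Gamma}_n-\hat{\Sigma}_n\beta_n)\right\|_2\ \le\ \frac{2\,\mathcal{D}_{2n}^{\Sigma}\,\left\|\Sigma_n^{-1}(\hat{\Gamma}_n-\hat{\Sigma}_n\beta_n)\right\|_2}{\Lambda_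n}.$$
   Context: $\|\cdot\|_2$ is the Euclidean norm, $\|\cdot\|_{op}$ is the operator (spectral) norm of a matrix, and $\lambda_{\min}(\cdot)$ is the smallest eigenvalue of a symmetric matrix. The result is deterministic: the inequalities hold for every realization of the data for which $\mathcal{D}_{2n}^{\Sigma}\le\Lambda_n/2$. *)

theory Defs
  imports "HOL-Probability.Probability"
begin

definition outer_product :: "real ^ 'p \<Rightarrow> real ^ 'p \<Rightarrow> real ^ 'p ^ 'p"
  where "outer_product x y = (\<chi> i j. x $ i * y $ j)"

text \<open>The data are \<open>X i :: 'a \<Rightarrow> real ^ 'p\<close> and \<open>Y i :: 'a \<Rightarrow> real\<close> on the sample space of \<open>M\<close>,
  with observations numbered \<open>1, \<dots>, n\<close>; \<open>\<omega>\<close> is a realization.\<close>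

definition Sigma_hat :: "(nat \<Rightarrow> 'a \<Rightarrow> real ^ 'p) \<Rightarrow> nat \<Rightarrow> 'a \<Rightarrow> real ^ 'p ^ 'p"
  where "Sigma_hat X n \<omega> = (1 / real n) *\<^sub>R (\<Sum>i=1..n. outer_product (X i \<omega>) (X i \<omega>))"

definition Gamma_hat ::
    "(nat \<Rightarrow> 'a \<Rightarrow> real ^ 'p) \<Rightarrow> (nat \<Rightarrow> 'a \<Rightarrow> real) \<Rightarrow> nat \<Rightarrow> 'a \<Rightarrow> real ^ 'p"
  where "Gamma_hat X Y n \<omega> = (1 / real n) *\<^sub>R (\<Sum>i=1..n. Y i \<omega> *\<^sub>R X i \<omega>)"

definition Sigma_mean ::
    "'a measure \<Rightarrow> (nat \<Rightarrow> 'a \<Rightarrow> real ^ 'p) \<Rightarrow> nat \<Rightarrow> real ^ 'p ^ 'p"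
  where "Sigma_mean M X n =
    (1 / real n) *\<^sub>R (\<Sum>i=1..n. \<integral>\<omega>. outer_product (X i \<omega>) (X i \<omega>) \<partial>M)"

definition Gamma_mean ::
    "'a measure \<Rightarrow> (nat \<Rightarrow> 'a \<Rightarrow> real ^ 'p) \<Rightarrow> (nat \<Rightarrow> 'a \<Rightarrow> real) \<Rightarrow> nat \<Rightarrow> real ^ 'p"
  where "Gamma_mean M X Y n =
    (1 / real n) *\<^sub>R (\<Sum>i=1..n. \<integral>\<omega>. Y i \<omega> *\<^sub>R X i \<omega> \<partial>M)"

definition beta_hat ::
    "(nat \<Rightarrow> 'a \<Rightarrow> real ^ 'p) \<Rightarrow> (nat \<Rightarrow> 'a \<Rightarrow> real) \<Rightarrow> nat \<Rightarrow> 'a \<Rightarrow> real ^ 'p"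
  where "beta_hat X Y n \<omega> = matrix_inv (Sigma_hat X n \<omega>) *v Gamma_hat X Y n \<omega>"

definition beta_mean ::
    "'a measure \<Rightarrow> (nat \<Rightarrow> 'a \<Rightarrow> real ^ 'p) \<Rightarrow> (nat \<Rightarrow> 'a \<Rightarrow> real) \<Rightarrow> nat \<Rightarrow> real ^ 'p"
  where "beta_mean M X Y n = matrix_inv (Sigma_mean M X n) *v Gamma_mean M X Y n"

definition is_eigenvalue :: "real ^ 'p ^ 'p \<Rightarrow> real \<Rightarrow> bool"
  where "is_eigenvalue A c \<longleftrightarrow> (\<exists>v. v \<noteq> 0 \<and> A *v v = c *\<^sub>R v)"

text \<open>Only meaningful if \<open>A\<close> has a real eigenvalue, as every symmetric matrix does.\<close>

definition lambda_min :: "real ^ 'p ^ 'p \<Rightarrow> real"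
  where "lambda_min A = (LEAST c. is_eigenvalue A c)"

definition op_norm :: "real ^ 'p ^ 'p \<Rightarrow> real"
  where "op_norm A = onorm (\<lambda>v. A *v v)"

definition D2_Sigma :: "'a measure \<Rightarrow> (nat \<Rightarrow> 'a \<Rightarrow> real ^ 'p) \<Rightarrow> nat \<Rightarrow> 'a \<Rightarrow> real"
  where "D2_Sigma M X n \<omega> = op_norm (Sigma_hat X n \<omega> - Sigma_mean M X n)"

text \<open>The leading linear term of \<open>beta_hat - beta_mean\<close>.\<close>

definition lin_term ::
    "'a measure \<Rightarrow> (nat \<Rightarrow> 'a \<Rightarrow> real ^ 'p) \<Rightarrow> (nat \<Rightarrow> 'a \<Rightarrow> real) \<Rightarrow> nat \<Rightarrow> 'a \<Rightarrow> real ^ 'p"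
  where "lin_term M X Y n \<omega> =
    matrix_inv (Sigma_mean M X n) *v
      (Gamma_hat X Y n \<omega> - Sigma_hat X n \<omega> *v beta_mean M X Y n)"

end

theory Submission
  imports Defs
begin

text \<open>Write \<open>S\<close> for \<open>Sigma_mean\<close>, \<open>T\<close> for \<open>Sigma_hat\<close>, \<open>b\<close> for the estimation error and \<open>L\<close> for
  \<open>lin_term\<close>. The smallest eigenvalue of the symmetric matrix \<open>S\<close> is the minimum of its Rayleigh
  quotient, so \<open>\<Lambda> * norm v \<le> norm (S *v v)\<close>, and \<open>\<Lambda> > 0\<close> because \<open>S\<close> is invertible and positive
  semidefinite. As \<open>D \<le> \<Lambda> / 2\<close>, the matrix \<open>T\<close> is injective, so both normal equations hold and
  give \<open>S *v L = T *v b\<close>. Hence \<open>S *v (b - L) = - ((T - S) *v b)\<close> and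
  \<open>\<Lambda> * norm (b - L) \<le> D * norm b\<close>; all three bounds follow from this by the triangle
  inequality.\<close>

lemma inner_matrix_vector_symmetric:
  fixes A :: "real ^ 'p ^ 'p"
  assumes "transpose A = A"
  shows "x \<bullet> (A *v y) = (A *v x) \<bullet> y"
  by (metis assms dot_lmul_matrix transpose_matrix_vector)

text \<open>With \<open>u = B *v w\<close>, the quadratic form at \<open>w - t *\<^sub>R u\<close>
  is \<open>t\<^sup>2 * q - 2 * t * (u \<bullet> u)\<close>, which is negative for small positive
  \<open>t\<close> unless \<open>u = 0\<close>.\<close>

lemma psd_kernel:
  fixes B :: "real ^ 'p ^ 'p"
  assumes sym: "transpose B = B" and psd: "\<And>v. 0 \<le> v \<bullet> (B *v v)" and w: "w \<bullet> (B *v w) = 0"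
  shows "B *v w = 0"
proof -
  define u where "u = B *v w"
  define q where "q = u \<bullet> (B *v u)"
  \<comment> \<open>The \<open>+ 1\<close> keeps the denominator positive even when
    \<open>q = 0\<close>, and gives \<open>t * q = u \<bullet> u - t\<close>.\<close>
  define t where "t = (u \<bullet> u) / (q + 1)"
  have q: "0 \<le> q" unfolding q_def by (rule psd)
  have "0 \<le> (w - t *\<^sub>R u) \<bullet> (B *v (w - t *\<^sub>R u))" by (rule psd)
  also have "\<dots> = t * (t * q - 2 * (u \<bullet> u))"
    using w inner_matrix_vector_symmetric[OF sym, of w u]
    by (simp add: matrix_vector_mult_diff_distrib matrix_vector_mult_scaleR inner_diff
        inner_commute u_def[symmetric] q_def[symmetric] algebra_simps)
  also have "t * q - 2 * (u \<bullet> u) = - (u \<bullet> u) - t"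
    using q by (simp add: t_def field_simps)
  finally have "t * (u \<bullet> u + t) \<le> 0" by (simp add: algebra_simps)
  moreover have "0 \<le> t * (u \<bullet> u)" using q by (simp add: t_def)
  ultimately have "t * t \<le> 0" by (simp add: distrib_left)
  then have "t = 0" by (auto simp: mult_le_0_iff)
  then show ?thesis using q by (simp add: t_def u_def)
qed

text \<open>The quadratic form attains its minimum on the compact unit sphere; homogeneity of degree
  two extends the bound to all \<open>v\<close>.\<close>

lemma rayleigh_minimum:
  fixes A :: "real ^ 'p ^ 'p"
  obtains w where "norm w = 1" "\<And>v. (w \<bullet> (A *v w)) * (norm v)\<^sup>2 \<le> v \<bullet> (A *v v)"
proof -
  have "sphere (0 :: real ^ 'p) 1 \<noteq> {}" by simp
  moreover have "continuous_on (sphere 0 1) (\<lambda>v. v \<bullet> (A *v v))"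
    by (intro continuous_intros linear_continuous_on matrix_vector_mul_bounded_linear)
  ultimately have "\<exists>w\<in>sphere 0 1. \<forall>v\<in>sphere 0 1. w \<bullet> (A *v w) \<le> v \<bullet> (A *v v)"
    by (rule continuous_attains_inf[OF compact_sphere])
  then obtain w where w: "w \<in> sphere 0 1"
    and min: "\<And>v. v \<in> sphere 0 1 \<Longrightarrow> w \<bullet> (A *v w) \<le> v \<bullet> (A *v v)"
    by blast
  have "(w \<bullet> (A *v w)) * (norm v)\<^sup>2 \<le> v \<bullet> (A *v v)" for v
  proof (cases "v = 0")
    case False
    then have "w \<bullet> (A *v w) \<le> (v /\<^sub>R norm v) \<bullet> (A *v (v /\<^sub>R norm v))"
      by (intro min) simp
    also have "\<dots> = (v \<bullet> (A *v v)) / (norm v)\<^sup>2"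
      by (simp add: matrix_vector_mult_scaleR power2_eq_square divide_simps)
    finally show ?thesis using False by (simp add: field_simps)
  qed simp
  with w that show thesis by simp
qed

text \<open>Shifting \<open>A\<close> by the Rayleigh minimum \<open>m\<close> gives a positive
  semidefinite \<open>B\<close> whose form vanishes at the minimizer \<open>w\<close>, so
  \<open>psd_kernel\<close> makes \<open>w\<close> an eigenvector. Every eigenvalue is a value of
  the Rayleigh quotient, hence at least \<open>m\<close>; so the \<open>LEAST\<close> exists and
  equals \<open>m\<close>.\<close>

lemma symmetric_lambda_min:
  fixes A :: "real ^ 'p ^ 'p"
  assumes sym: "transpose A = A"
  shows "is_eigenvalue A (lambda_min A)"
    and "lambda_min A * (norm v)\<^sup>2 \<le> v \<bullet> (A *v v)"
proof -
  obtain w where w: "norm w = 1"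
    and min: "\<And>v. (w \<bullet> (A *v w)) * (norm v)\<^sup>2 \<le> v \<bullet> (A *v v)"
    using rayleigh_minimum by blast
  define m where "m = w \<bullet> (A *v w)"
  define B where "B = A - m *\<^sub>R mat 1"
  have B: "B *v v = A *v v - m *\<^sub>R v" for v
    by (simp add: B_def matrix_vector_mult_diff_rdistrib flip: scaleR_matrix_vector_assoc)
  have "transpose B = B"
    using sym by (simp add: B_def transpose_def vec_eq_iff mat_def)
  moreover have "0 \<le> v \<bullet> (B *v v)" for v
    using min[of v] by (simp add: B m_def inner_diff_right power2_norm_eq_inner)
  moreover have "w \<bullet> (B *v w) = 0"
    using w by (simp add: B m_def inner_diff_right norm_eq_1)
  ultimately have "B *v w = 0" by (rule psd_kernel)
  then have "A *v w = m *\<^sub>R w" by (simp add: B)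
  then have ev: "is_eigenvalue A m"
    unfolding is_eigenvalue_def using w by (intro exI[of _ w] conjI) auto
  have le: "m \<le> c" if c: "is_eigenvalue A c" for c
  proof -
    obtain v where v: "v \<noteq> 0" "A *v v = c *\<^sub>R v"
      using c unfolding is_eigenvalue_def by blast
    have "m * (norm v)\<^sup>2 \<le> v \<bullet> (A *v v)"
      unfolding m_def by (rule min)
    also have "\<dots> = c * (norm v)\<^sup>2"
      by (simp add: v(2) power2_norm_eq_inner)
    finally show ?thesis using v(1) by simp
  qed
  have "lambda_min A = m"
    unfolding lambda_min_def using ev le by (rule Least_equality)
  then show "is_eigenvalue A (lambda_min A)"
    and "lambda_min A * (norm v)\<^sup>2 \<le> v \<bullet> (A *v v)"
    using ev min[of v] by (simp_all only: m_def)
qed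

lemma lambda_min_norm_le:
  fixes A :: "real ^ 'p ^ 'p"
  assumes "transpose A = A"
  shows "lambda_min A * norm v \<le> norm (A *v v)"
proof (cases "v = 0")
  case False
  have "norm v * (lambda_min A * norm v) \<le> v \<bullet> (A *v v)"
    using symmetric_lambda_min(2)[OF assms, of v] by (simp add: power2_eq_square mult_ac)
  also have "\<dots> \<le> norm v * norm (A *v v)" by (rule norm_cauchy_schwarz)
  finally show ?thesis using False by simp
qed simp

text \<open>At an eigenvector for \<open>lambda_min A\<close>, semidefiniteness excludes a negative
  value and the trivial kernel excludes zero.\<close>

lemma lambda_min_pos:
  fixes A :: "real ^ 'p ^ 'p"
  assumes sym: "transpose A = A" and psd: "\<And>v. 0 \<le> v \<bullet> (A *v v)" and inv: "invertible A"
  shows "0 < lambda_min A"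
proof -
  obtain v where v: "v \<noteq> 0" "A *v v = lambda_min A *\<^sub>R v"
    using symmetric_lambda_min(1)[OF sym] unfolding is_eigenvalue_def by blast
  have "0 \<le> lambda_min A * (v \<bullet> v)" using psd[of v] v by simp
  then have "0 \<le> lambda_min A" using v(1) by (simp add: zero_le_mult_iff flip: inner_gt_zero_iff)
  moreover have "lambda_min A \<noteq> 0"
    using v inv by (auto simp: invertible_left_inverse matrix_left_invertible_ker)
  ultimately show ?thesis by simp
qed

lemma norm_matrix_vector_le_op_norm: "norm (A *v v) \<le> op_norm A * norm v"
  unfolding op_norm_def by (intro onorm matrix_vector_mul_bounded_linear)

lemma matrix_inv_vector_mult:
  fixes A :: "real ^ 'p ^ 'p"
  assumes "invertible A"
  shows "A *v (matrix_inv A *v x) = x"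
proof -
  have "A ** matrix_inv A = mat 1 \<and> matrix_inv A ** A = mat 1"
    using assms unfolding invertible_def matrix_inv_def by (rule someI_ex)
  then show ?thesis by (simp add: matrix_vector_mul_assoc)
qed

lemma transpose_outer_product: "transpose (outer_product x x) = outer_product x x"
  by (simp add: transpose_def outer_product_def vec_eq_iff mult.commute)

lemma inner_outer_product: "v \<bullet> (outer_product x y *v v) = (v \<bullet> x) * (v \<bullet> y)"
proof -
  have "outer_product x y *v v = (v \<bullet> y) *\<^sub>R x"
    by (simp add: inner_vec_def outer_product_def matrix_vector_mult_def vec_eq_iff
        sum_distrib_left sum_distrib_right mult_ac)
  then show ?thesis by (simp add: mult.commute)
qed

lemma integral_commute_linear:
  fixes T :: "'b::euclidean_space \<Rightarrow> 'c::euclidean_space"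
  assumes "linear T" and "integrable M f"
  shows "(\<integral>x. T (f x) \<partial>M) = T (\<integral>x. f x \<partial>M)"
  using assms by (intro integral_bounded_linear) (auto simp: linear_conv_bounded_linear)

lemma linear_transpose: "linear (transpose :: real ^ 'p ^ 'p \<Rightarrow> real ^ 'p ^ 'p)"
  by (intro linearI) (simp_all add: transpose_def vec_eq_iff)

text \<open>Linearity in the matrix, for fixed \<open>v\<close>, lets the form pass through the
  average and the expectation in \<open>Sigma_mean\<close>.\<close>

lemma linear_quadratic_form: "linear (\<lambda>A :: real ^ 'p ^ 'p. v \<bullet> (A *v v))"
  by (intro linearI)
    (simp_all add: matrix_vector_mult_add_rdistrib inner_add_right flip: scaleR_matrix_vector_assoc)

text \<open>In the non-integrable case the integral is \<open>0\<close>, so both properties hold there trivially.\<close>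

lemma transpose_second_moment:
  "transpose (\<integral>\<omega>. outer_product (f \<omega>) (f \<omega>) \<partial>M) = (\<integral>\<omega>. outer_product (f \<omega>) (f \<omega>) \<partial>M)"
proof (cases "integrable M (\<lambda>\<omega>. outer_product (f \<omega>) (f \<omega>))")
  case True
  then show ?thesis
    using integral_commute_linear[OF linear_transpose True] by (simp add: transpose_outer_product)
qed (simp add: not_integrable_integral_eq transpose_def vec_eq_iff)

lemma psd_second_moment:
  "0 \<le> v \<bullet> ((\<integral>\<omega>. outer_product (f \<omega>) (f \<omega>) \<partial>M) *v v)"
proof (cases "integrable M (\<lambda>\<omega>. outer_product (f \<omega>) (f \<omega>))")
  case True
  then show ?thesis
    using integral_commute_linear[OF linear_quadratic_form True, of v, symmetric]
    by (simp add: inner_outer_product)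
qed (simp add: not_integrable_integral_eq)

lemma transpose_Sigma_mean: "transpose (Sigma_mean M X n) = Sigma_mean M X n"
  by (simp add: Sigma_mean_def linear_cmul[OF linear_transpose] linear_sum[OF linear_transpose]
      transpose_second_moment)

lemma psd_Sigma_mean: "0 \<le> v \<bullet> (Sigma_mean M X n *v v)"
  unfolding Sigma_mean_def linear_cmul[OF linear_quadratic_form] linear_sum[OF linear_quadratic_form]
  by (simp add: sum_nonneg psd_second_moment)

theorem theorem8p1:
  fixes M :: "'a measure"
    and X :: "nat \<Rightarrow> 'a \<Rightarrow> real ^ 'p"
    and Y :: "nat \<Rightarrow> 'a \<Rightarrow> real"
    and n :: nat
    and \<omega> :: 'a
  assumes "prob_space M"
    and "n \<ge> 1"
    and "\<And>i. i \<in> {1..n} \<Longrightarrow> X i \<in> borel_measurable M"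
    and "\<And>i. i \<in> {1..n} \<Longrightarrow> Y i \<in> borel_measurable M"
    and "\<And>i. i \<in> {1..n} \<Longrightarrow> integrable M (\<lambda>\<xi>. (norm (X i \<xi>))\<^sup>2)"
    and "\<And>i. i \<in> {1..n} \<Longrightarrow> integrable M (\<lambda>\<xi>. (Y i \<xi>)\<^sup>2)"
    and "invertible (Sigma_mean M X n)"
    and "\<omega> \<in> space M"
    and "D2_Sigma M X n \<omega> \<le> lambda_min (Sigma_mean M X n) / 2"
  shows "1 / 2 * norm (lin_term M X Y n \<omega>) \<le> norm (beta_hat X Y n \<omega> - beta_mean M X Y n)
    \<and> norm (beta_hat X Y n \<omega> - beta_mean M X Y n) \<le> 2 * norm (lin_term M X Y n \<omega>)
    \<and> norm (beta_hat X Y n \<omega> - beta_mean M X Y n - lin_term M X Y n \<omega>)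
      \<le> 2 * D2_Sigma M X n \<omega> * norm (lin_term M X Y n \<omega>) / lambda_min (Sigma_mean M X n)"
proof -
  define S where "S = Sigma_mean M X n"
  define T where "T = Sigma_hat X n \<omega>"
  define D where "D = D2_Sigma M X n \<omega>"
  define \<Lambda> where "\<Lambda> = lambda_min S"
  define L where "L = lin_term M X Y n \<omega>"
  define b where "b = beta_hat X Y n \<omega> - beta_mean M X Y n"
  have invS: "invertible S" using assms(7) by (simp add: S_def)
  have S_lower: "\<Lambda> * norm v \<le> norm (S *v v)" for v
    unfolding \<Lambda>_def S_def by (intro lambda_min_norm_le transpose_Sigma_mean)
  have \<Lambda>: "0 < \<Lambda>"
    unfolding \<Lambda>_def S_def
    using transpose_Sigma_mean psd_Sigma_mean assms(7) by (rule lambda_min_pos)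
  have D: "D \<le> \<Lambda> / 2" using assms(9) by (simp add: D_def \<Lambda>_def S_def)
  have dev: "norm ((T - S) *v v) \<le> D * norm v" for v
    by (simp add: D_def D2_Sigma_def T_def S_def norm_matrix_vector_le_op_norm)
  have D_nonneg: "0 \<le> D"
    unfolding D_def D2_Sigma_def op_norm_def by (intro onorm_pos_le matrix_vector_mul_bounded_linear)
  \<comment> \<open>On the kernel of \<open>T\<close>, the deviation \<open>T - S\<close> acts as
    \<open>- S\<close>, so the lower bound for \<open>S\<close> meets the upper bound
    \<open>D\<close>.\<close>
  have "v = 0" if "T *v v = 0" for v
  proof -
    have "\<Lambda> * norm v \<le> D * norm v"
      using S_lower[of v] dev[of v] that by (simp add: matrix_vector_mult_diff_rdistrib)
    also have "\<dots> \<le> \<Lambda> / 2 * norm v" using D by (rule mult_right_mono) simp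
    finally show ?thesis using \<Lambda> by simp
  qed
  then have invT: "invertible T"
    by (simp add: invertible_left_inverse matrix_left_invertible_ker)
  \<comment> \<open>Both sides equal
    \<open>Gamma_hat X Y n \<omega> - T *v beta_mean M X Y n\<close>.\<close>
  have "S *v L = T *v b"
    using matrix_inv_vector_mult[OF invS] matrix_inv_vector_mult[OF invT]
    by (simp add: L_def lin_term_def b_def beta_hat_def matrix_vector_mult_diff_distrib
        flip: S_def T_def)
  then have "S *v (b - L) = - ((T - S) *v b)"
    by (simp add: matrix_vector_mult_diff_distrib matrix_vector_mult_diff_rdistrib)
  then have err: "\<Lambda> * norm (b - L) \<le> D * norm b"
    using S_lower[of "b - L"] dev[of b] by simp
  also have "\<dots> \<le> \<Lambda> / 2 * norm b" using D by (rule mult_right_mono) simp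
  also have "\<dots> = \<Lambda> * (norm b / 2)" by simp
  finally have "norm (b - L) \<le> norm b / 2" using \<Lambda> by simp
  \<comment> \<open>The triangle inequality gives \<open>norm L \<le> 3 / 2 * norm b\<close>,
    stronger than the lower bound, and \<open>norm b / 2 \<le> norm L\<close>.\<close>
  then have lower: "1 / 2 * norm L \<le> norm b" and upper: "norm b \<le> 2 * norm L"
    using norm_triangle_ineq2[of b L] norm_triangle_ineq2[of L b] norm_minus_commute[of b L]
      norm_ge_zero[of b] by linarith+
  \<comment> \<open>Here \<open>err\<close> is used with \<open>D\<close> kept, instead of its
    weakening to \<open>\<Lambda> / 2\<close>, and \<open>norm b\<close> is replaced through
    \<open>upper\<close>.\<close>
  have "\<Lambda> * norm (b - L) \<le> D * (2 * norm L)"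
    using err mult_left_mono[OF upper D_nonneg] by linarith
  then have "norm (b - L) \<le> 2 * D * norm L / \<Lambda>"
    using \<Lambda> by (simp add: field_simps)
  with lower upper show ?thesis
    by (simp add: L_def b_def D_def \<Lambda>_def S_def)
qed

end
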